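(* Let $f:\mathbb{R}^d\to(-\infty,+\infty]$ be proper, lower semicontinuous and $\rho$-weakly convex with $\rho>0$, and let $x\in\operatorname{dom} f$. 1) Let $\bar\rho\ge 0$, $\varepsilon\ge 0$. If $v$ is a $(\bar\rho,\varepsilon)$-subgradient of $f$ at $x$, then for every $\hat\rho>\max\{\bar\rho,\rho\}$ the point $x$ is a $$\left(\sqrt{\tfrac{2\varepsilon}{\hat\rho-\rho}},\ \|v\|+\hat\rho\sqrt{\tfrac{2\varepsilon}{\hat\rho-\rho}}\right)\text{-stationary point of }\min_x f(x).$$ If $\varepsilon=0$ and $\bar\rho=\rho$, then $v\in\partial f(x)$. 2) Conversely, if $x$ is an $(\eta/\rho,\eta)$-stationary point of $\min_x f(x)$ (with $\eta>0$), then there exists a $(\rho,\varepsilon)$-subgradient $v$ of $f$ at $x$ with $\|v\|\le 2\eta$, where $\varepsilon:=\frac{2\eta^2}{\rho}+\frac{\eta\,\|\partial f(x)\|}{\rho}$.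
   Context: $\|\cdot\|$ is the Euclidean norm. A function $f$ is $\rho$-weakly convex if $f+\frac{\rho}{2}\|\cdot\|^2$ is convex. $\partial f(x)$ is the (Fréchet = limiting) subdifferential: $v\in\partial f(x)$ iff $f(y)\ge f(x)+\langle v,y-x\rangle+o(\|y-x\|)$ as $y\to x$. For a set $S$, $\|S\|:=\operatorname{dist}(0,S)=\inf_{s\in S}\|s\|$ (with $\inf\emptyset=+\infty$). Approximate subgradient: for $\bar\rho\ge 0,\varepsilon\ge0$, $u\in\mathbb{R}^d$ is a $(\bar\rho,\varepsilon)$-subgradient of $f$ at $x\in\operatorname{dom} f$ if $f(y)\ge f(x)+\langle u,y-x\rangle-\frac{\bar\rho}{2}\|y-x\|^2-\varepsilon$ for all $y\in\mathbb{R}^d$. (When $\varepsilon=+\infty$ the inequality is vacuous.) Approximate stationarity: $x$ is a $(\delta,\varepsilon')$-stationary point of $\min f$ if there exists $\hat x\in\operatorname{dom} f$ with $\|\hat x-x\|\le\delta$ and $\|\partial f(\hat x)\|\le\varepsilon'$. *)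

theory Defs
  imports "HOL-Analysis.Analysis" "HOL-Library.Landau_Symbols"
begin

definition edom :: "('a \<Rightarrow> ereal) \<Rightarrow> 'a set" where
  "edom f = {x. f x < \<infinity>}"

definition proper_fun :: "('a \<Rightarrow> ereal) \<Rightarrow> bool" where
  "proper_fun f \<longleftrightarrow> (\<forall>x. f x \<noteq> -\<infinity>) \<and> edom f \<noteq> {}"

definition lower_semicontinuous :: "('a::topological_space \<Rightarrow> ereal) \<Rightarrow> bool" where
  "lower_semicontinuous f \<longleftrightarrow> (\<forall>x. f x \<le> Liminf (at x) f)"

text \<open>The library's \<^const>\<open>convex_on\<close> is for real-valued functions only.\<close>

definition econvex :: "('a::real_vector \<Rightarrow> ereal) \<Rightarrow> bool" where
  "econvex f \<longleftrightarrow> (\<forall>x y u v. 0 < u \<longrightarrow> 0 < v \<longrightarrow> u + v = 1 \<longrightarrow>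
      f (u *\<^sub>R x + v *\<^sub>R y) \<le> ereal u * f x + ereal v * f y)"

definition weakly_convex :: "real \<Rightarrow> ('a::real_normed_vector \<Rightarrow> ereal) \<Rightarrow> bool" where
  "weakly_convex \<rho> f \<longleftrightarrow> econvex (\<lambda>x. f x + ereal (\<rho> / 2 * (norm x)\<^sup>2))"

text \<open>The remainder \<open>r\<close> is the term \<open>o(\<parallel>y - x\<parallel>)\<close>.
  The subdifferential is empty outside the domain of \<open>f\<close>.\<close>

definition subdifferential :: "('a::real_inner \<Rightarrow> ereal) \<Rightarrow> 'a \<Rightarrow> 'a set" where
  "subdifferential f x = {v. x \<in> edom f \<and>
     (\<exists>r. r \<in> o[at x](\<lambda>y. norm (y - x)) \<and>
       (\<forall>\<^sub>F y in at x. f y \<ge> f x + ereal (v \<bullet> (y - x) + r y)))}"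

text \<open>The distance from the origin to \<open>S\<close>, equal to \<open>\<infinity>\<close> for empty \<open>S\<close>
  (the library's \<^const>\<open>infdist\<close> is \<open>0\<close> there).\<close>

definition set_norm :: "'a::real_normed_vector set \<Rightarrow> ereal" where
  "set_norm S = (INF s\<in>S. ereal (norm s))"

definition approx_subgradient ::
    "real \<Rightarrow> ereal \<Rightarrow> ('a::real_inner \<Rightarrow> ereal) \<Rightarrow> 'a \<Rightarrow> 'a \<Rightarrow> bool" where
  "approx_subgradient \<rho> \<epsilon> f x u \<longleftrightarrow> x \<in> edom f \<and>
     (\<forall>y. f y \<ge> f x + ereal (u \<bullet> (y - x)) - ereal (\<rho> / 2 * (norm (y - x))\<^sup>2) - \<epsilon>)"

definition approx_stationary ::
    "real \<Rightarrow> real \<Rightarrow> ('a::real_inner \<Rightarrow> ereal) \<Rightarrow> 'a \<Rightarrow> bool" where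
  "approx_stationary \<delta> \<epsilon> f x \<longleftrightarrow>
     (\<exists>z\<in>edom f. norm (z - x) \<le> \<delta> \<and> set_norm (subdifferential f z) \<le> ereal \<epsilon>)"

end

theory Submission
  imports Defs
begin

text \<open>Part 1 minimises the strongly convex function
  \<open>y \<mapsto> f y - v \<bullet> (y - x) + \<rho>h / 2 * (norm (y - x))\<^sup>2\<close>. At a minimiser \<open>z\<close> the vector
  \<open>v - \<rho>h (z - x)\<close> is a subgradient of \<open>f\<close>, and comparing the subgradient inequality at \<open>z\<close>,
  evaluated in \<open>x\<close>, with the approximate one at \<open>x\<close>, evaluated in \<open>z\<close>, bounds \<open>norm (z - x)\<close>.
  For part 2, weak convexity turns the local subgradient inequality into the global one
  with quadratic error \<open>\<rho> / 2 * (norm (y - z))\<^sup>2\<close>. So a minimal-norm \<open>v\<close> in the subdifferential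
  at the nearby point \<open>z\<close> yields the approximate subgradient \<open>v - \<rho> (x - z)\<close> at \<open>x\<close>;
  the gap \<open>f x - f z\<close> is controlled by a subgradient at \<open>x\<close>.\<close>

section \<open>Finite values and the real form of the approximate subgradient inequality\<close>

lemma edom_realE:
  assumes "proper_fun f" "x \<in> edom f"
  obtains a where "f x = ereal a"
  using assms by (cases "f x") (auto simp: proper_fun_def edom_def)

text \<open>With \<open>f x\<close> and the error both finite, the lower bound collapses to one real
  number, so only \<open>f y\<close> stays extended.\<close>

lemma approx_subgradient_real_iff:
  assumes "f x = ereal a"
  shows "approx_subgradient \<rho> (ereal \<epsilon>) f x u \<longleftrightarrow>
    (\<forall>y. ereal (a + u \<bullet> (y - x) - \<rho> / 2 * (norm (y - x))\<^sup>2 - \<epsilon>) \<le> f y)"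
  using assms by (simp add: approx_subgradient_def edom_def)

section \<open>Lower semicontinuity and attainment of minima\<close>

text \<open>\<open>Liminf (at x) f\<close> ignores the value at \<open>x\<close>, but a superlevel
  set is tested only at points it contains. Open superlevel sets suit sums and covering
  arguments.\<close>

lemma lower_semicontinuous_iff_open:
  fixes f :: "'a::topological_space \<Rightarrow> ereal"
  shows "lower_semicontinuous f \<longleftrightarrow> (\<forall>c. open {x. c < f x})"
proof
  assume lsc: "lower_semicontinuous f"
  show "\<forall>c. open {x. c < f x}"
  proof (intro allI, subst open_subopen, intro ballI)
    fix c x assume "x \<in> {x. c < f x}"
    then have cx: "c < f x" by simp
    have "\<forall>\<^sub>F y in at x. c < f y"
      using lsc cx unfolding lower_semicontinuous_def le_Liminf_iff by blast
    then show "\<exists>T. open T \<and> x \<in> T \<and> T \<subseteq> {x. c < f x}"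
      using cx unfolding eventually_at_topological by auto
  qed
next
  assume op: "\<forall>c. open {x. c < f x}"
  show "lower_semicontinuous f"
    unfolding lower_semicontinuous_def
  proof
    fix x
    have "\<forall>\<^sub>F y in at x. c < f y" if "c < f x" for c
      unfolding eventually_at_topological
      using op that by (intro exI[of _ "{y. c < f y}"]) auto
    then show "f x \<le> Liminf (at x) f" unfolding le_Liminf_iff by blast
  qed
qed

text \<open>A real \<open>s\<close> inserted strictly between \<open>c - q x\<close> and
  \<open>f x\<close> separates the two summands, so the superlevel set of the sum is a union of
  intersections of open sets.\<close>

lemma lower_semicontinuous_add_continuous:
  fixes f :: "'a::topological_space \<Rightarrow> ereal"
  assumes "lower_semicontinuous f" "continuous_on UNIV q" "\<And>x. f x \<noteq> -\<infinity>"
  shows "lower_semicontinuous (\<lambda>x. f x + ereal (q x))"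
  unfolding lower_semicontinuous_iff_open
proof
  fix c :: ereal
  have "{x. c < f x + ereal (q x)} = (\<Union>s. {x. ereal s < f x} \<inter> {x. c < ereal (s + q x)})"
  proof (intro set_eqI iffI)
    fix x assume "x \<in> {x. c < f x + ereal (q x)}"
    then have "c - ereal (q x) < f x"
      using assms(3)[of x] by (cases c; cases "f x") auto
    then obtain s where "c - ereal (q x) < ereal s" "ereal s < f x"
      using ereal_dense2 by blast
    then show "x \<in> (\<Union>s. {x. ereal s < f x} \<inter> {x. c < ereal (s + q x)})"
      by (cases c) (auto intro!: exI[of _ s])
  next
    fix x assume "x \<in> (\<Union>s. {x. ereal s < f x} \<inter> {x. c < ereal (s + q x)})"
    then obtain s where s: "ereal s < f x" "c < ereal (s + q x)" by auto
    have "ereal (s + q x) \<le> f x + ereal (q x)"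
      using s(1) by (cases "f x") auto
    then show "x \<in> {x. c < f x + ereal (q x)}" using s(2) by auto
  qed
  moreover have "open {x. ereal s < f x}" for s
    using assms(1) by (simp add: lower_semicontinuous_iff_open)
  moreover have "open {x. c < ereal (s + q x)}" for s
    by (intro open_Collect_less continuous_intros assms(2))
  ultimately show "open {x. c < f x + ereal (q x)}"
    by (simp only:) (intro open_UN ballI open_Int; simp)
qed

text \<open>Without a minimiser the open sets \<open>{z. f y < f z}\<close> with \<open>y\<close> in
  \<open>K\<close> would cover \<open>K\<close>; in a finite subcover, an index of least value lies
  in none of the sets.\<close>

lemma lower_semicontinuous_attains_inf:
  fixes f :: "'a::topological_space \<Rightarrow> ereal"
  assumes lsc: "lower_semicontinuous f" and "compact K" "K \<noteq> {}"
  shows "\<exists>z\<in>K. \<forall>y\<in>K. f z \<le> f y"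
proof (rule ccontr)
  assume "\<not> ?thesis"
  then have *: "\<exists>y\<in>K. f y < f z" if "z \<in> K" for z using that by (meson not_le)
  have "\<forall>y\<in>K. open {z. f y < f z}"
    using lsc by (simp add: lower_semicontinuous_iff_open)
  moreover have "K \<subseteq> (\<Union>y\<in>K. {z. f y < f z})" using * by blast
  ultimately obtain C where C: "C \<subseteq> K" "finite C" "K \<subseteq> (\<Union>y\<in>C. {z. f y < f z})"
    using compactE_image[OF \<open>compact K\<close>, of K "\<lambda>y. {z. f y < f z}"] by blast
  have "C \<noteq> {}" using C(3) \<open>K \<noteq> {}\<close> by auto
  then have "Min (f ` C) \<in> f ` C" using C(2) by simp
  then obtain y where y: "y \<in> C" "f y = Min (f ` C)" by auto
  then obtain y' where y': "y' \<in> C" "f y' < f y" using C(1,3) by blast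
  have "f y \<le> f y'" using C(2) y(2) y'(1) by simp
  then show False using y'(2) by simp
qed

section \<open>Elements of minimal norm\<close>

lemma set_norm_attained:
  fixes S :: "'a::euclidean_space set"
  assumes "closed S" "S \<noteq> {}"
  obtains v where "v \<in> S" "set_norm S = ereal (norm v)"
proof -
  obtain v where v: "v \<in> S" "\<And>y. y \<in> S \<Longrightarrow> dist 0 v \<le> dist 0 y"
    using distance_attains_inf[OF assms, of 0] by blast
  then have "set_norm S = ereal (norm v)"
    unfolding set_norm_def by (intro antisym INF_lower INF_greatest) auto
  with v(1) show thesis by (rule that)
qed

lemma set_norm_le_norm: "v \<in> S \<Longrightarrow> set_norm S \<le> ereal (norm v)"
  unfolding set_norm_def by (rule INF_lower)

section \<open>Subdifferentials under weak convexity\<close>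

text \<open>The quadratic error is itself \<open>o(norm (y - x))\<close>, so it serves as the
  remainder \<open>r\<close>.\<close>

lemma approx_subgradient_imp_subdifferential:
  assumes "proper_fun f" "approx_subgradient \<rho> 0 f x v"
  shows "v \<in> subdifferential f x"
proof -
  have x: "x \<in> edom f" using assms(2) by (simp add: approx_subgradient_def)
  obtain a where a: "f x = ereal a" using edom_realE[OF assms(1) x] .
  define r where "r y = - (\<rho> / 2 * (norm (y - x))\<^sup>2)" for y
  have "r \<in> o[at x](\<lambda>y. norm (y - x))"
  proof (rule landau_o.smallI)
    fix c :: real assume "c > 0"
    show "\<forall>\<^sub>F y in at x. norm (r y) \<le> c * norm (norm (y - x))"
      unfolding eventually_at
    \<comment> \<open>The absolute value allows either sign of \<open>\<rho>\<close>, and the added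
      1 keeps the denominator positive.\<close>
    proof (intro exI[of _ "c / (\<bar>\<rho>\<bar> + 1)"] conjI ballI impI)
      fix y assume "y \<noteq> x \<and> dist y x < c / (\<bar>\<rho>\<bar> + 1)"
      then have "(\<bar>\<rho>\<bar> + 1) * norm (y - x) \<le> c"
        by (simp add: dist_norm pos_less_divide_eq mult.commute)
      moreover have "\<bar>\<rho>\<bar> / 2 * norm (y - x) \<le> (\<bar>\<rho>\<bar> + 1) * norm (y - x)"
        by (intro mult_right_mono) auto
      ultimately have "\<bar>\<rho>\<bar> / 2 * norm (y - x) * norm (y - x) \<le> c * norm (y - x)"
        by (intro mult_right_mono) auto
      then show "norm (r y) \<le> c * norm (norm (y - x))"
        by (simp add: r_def abs_mult power2_eq_square)
    qed (use \<open>c > 0\<close> in auto)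
  qed
  moreover have "f x + ereal (v \<bullet> (y - x) + r y) \<le> f y" for y
    using assms(2) approx_subgradient_real_iff[where f = f and x = x, OF a, of \<rho> 0 v]
    by (simp add: a r_def zero_ereal_def algebra_simps)
  ultimately show ?thesis using x by (auto simp: subdifferential_def)
qed

text \<open>The extra term is the convexity defect of the squared norm: at weights
  \<open>1 - t\<close> and \<open>t\<close> it equals
  \<open>t * (1 - t) * (norm (y - x))\<^sup>2\<close>.\<close>

lemma weakly_convex_segment_le:
  fixes f :: "'a::real_inner \<Rightarrow> ereal"
  assumes "weakly_convex \<rho> f" "f x = ereal a" "f y = ereal b" "0 < t" "t < 1"
  shows "f (x + t *\<^sub>R (y - x))
    \<le> ereal ((1 - t) * a + t * b + \<rho> / 2 * (t * (1 - t) * (norm (y - x))\<^sup>2))"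
proof -
  let ?w = "x + t *\<^sub>R (y - x)"
  have w: "(1 - t) *\<^sub>R x + t *\<^sub>R y = ?w" by (simp add: algebra_simps)
  have "f ?w + ereal (\<rho> / 2 * (norm ?w)\<^sup>2) \<le>
      ereal (1 - t) * (f x + ereal (\<rho> / 2 * (norm x)\<^sup>2)) + ereal t * (f y + ereal (\<rho> / 2 * (norm y)\<^sup>2))"
    using assms(1,4,5) unfolding weakly_convex_def econvex_def w[symmetric] by simp
  also have "\<dots> = ereal ((1 - t) * a + t * b + \<rho> / 2 * (t * (1 - t) * (norm (y - x))\<^sup>2)
      + \<rho> / 2 * (norm ?w)\<^sup>2)"
    unfolding assms(2,3)
    by (simp add: power2_norm_eq_inner inner_simps inner_commute)
       (simp add: algebra_simps add_divide_distrib diff_divide_distrib)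
  finally show ?thesis by (cases "f ?w") auto
qed

text \<open>Near \<open>x\<close> on the segment towards \<open>y\<close>, the local inequality
  bounds \<open>f\<close> from below and weak convexity bounds it from above. Dividing by
  \<open>t\<close> carries the bound to \<open>y\<close>.\<close>

lemma subdifferential_weakly_convex:
  fixes f :: "'a::real_inner \<Rightarrow> ereal"
  assumes proper: "proper_fun f" and wc: "weakly_convex \<rho> f"
    and v: "v \<in> subdifferential f x"
    and "\<rho> \<ge> 0"
  shows "approx_subgradient \<rho> 0 f x v"
proof -
  have x: "x \<in> edom f" using v by (simp add: subdifferential_def)
  obtain a where a: "f x = ereal a" using edom_realE[OF proper x] .
  obtain r where r: "r \<in> o[at x](\<lambda>y. norm (y - x))"
    and lower: "\<forall>\<^sub>F y in at x. f y \<ge> f x + ereal (v \<bullet> (y - x) + r y)"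
    using v by (auto simp: subdifferential_def)
  have "ereal (a + v \<bullet> (y - x) - \<rho> / 2 * (norm (y - x))\<^sup>2) \<le> f y" for y
  proof (cases "y = x \<or> f y = \<infinity>")
    case True
    then show ?thesis using a by auto
  next
    case False
    then obtain b where b: "f y = ereal b"
      using proper by (cases "f y") (auto simp: proper_fun_def)
    define d where "d = y - x"
    have d: "norm d > 0" using False by (simp add: d_def)
    have "a + v \<bullet> d - \<rho> / 2 * (norm d)\<^sup>2 \<le> b + e" if "e > 0" for e
    proof -
      \<comment> \<open>With this rate the remainder costs exactly \<open>e\<close> after division
        by \<open>t\<close>, since \<open>c * norm d = e\<close>.\<close>
      define c where "c = e / norm d"
      have "c > 0" using that d by (simp add: c_def)
      have "\<forall>\<^sub>F y in at x. norm (r y) \<le> c * norm (norm (y - x))"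
        using r \<open>c > 0\<close> by (rule landau_o.smallD)
      with lower have "\<forall>\<^sub>F y in at x. f x + ereal (v \<bullet> (y - x) - c * norm (y - x)) \<le> f y"
      proof eventually_elim
        case (elim y)
        have "f x + ereal (v \<bullet> (y - x) - c * norm (y - x)) \<le> f x + ereal (v \<bullet> (y - x) + r y)"
          using elim(2) by (intro add_left_mono) simp
        then show ?case using elim(1) by order
      qed
      then obtain \<delta> where "\<delta> > 0" and \<delta>: "\<And>y. y \<noteq> x \<Longrightarrow> dist y x < \<delta> \<Longrightarrow>
          f x + ereal (v \<bullet> (y - x) - c * norm (y - x)) \<le> f y"
        unfolding eventually_at by auto
      \<comment> \<open>The halves make both \<open>t < 1\<close> and
        \<open>t * norm d < \<delta>\<close> strict.\<close>
      define t where "t = min (1 / 2) (\<delta> / (2 * norm d))"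
      have t: "0 < t" "t < 1" "t * norm d < \<delta>"
      proof -
        show "0 < t" "t < 1" using \<open>\<delta> > 0\<close> d by (auto simp: t_def)
        have "t * norm d \<le> \<delta> / (2 * norm d) * norm d"
          by (intro mult_right_mono) (auto simp: t_def)
        also have "\<dots> < \<delta>" using d \<open>\<delta> > 0\<close> by simp
        finally show "t * norm d < \<delta>" .
      qed
      have "ereal (a + (t * (v \<bullet> d) - c * (t * norm d))) \<le> f (x + t *\<^sub>R d)"
        using \<delta>[of "x + t *\<^sub>R d"] t d by (auto simp: dist_norm a)
      also have "\<dots> \<le> ereal ((1 - t) * a + t * b + \<rho> / 2 * (t * (1 - t) * (norm d)\<^sup>2))"
        using weakly_convex_segment_le[OF wc a b t(1,2)] by (simp add: d_def)
      finally have "a + (t * (v \<bullet> d) - c * (t * norm d))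
          \<le> (1 - t) * a + t * b + \<rho> / 2 * (t * (1 - t) * (norm d)\<^sup>2)" by simp
      then have "t * (a + v \<bullet> d - c * norm d) \<le> t * (b + \<rho> / 2 * (1 - t) * (norm d)\<^sup>2)"
        by (simp add: algebra_simps diff_divide_distrib)
      then have "a + v \<bullet> d - c * norm d \<le> b + \<rho> / 2 * (1 - t) * (norm d)\<^sup>2"
        using t(1) by simp
      also have "\<dots> \<le> b + \<rho> / 2 * (norm d)\<^sup>2"
        using t \<open>\<rho> \<ge> 0\<close> by (intro add_left_mono mult_right_mono) (auto intro: mult_left_le)
      finally show ?thesis using d by (simp add: c_def)
    qed
    then have "a + v \<bullet> d - \<rho> / 2 * (norm d)\<^sup>2 \<le> b" by (rule field_le_epsilon)
    then show ?thesis by (simp add: b d_def)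
  qed
  then show ?thesis
    using approx_subgradient_real_iff[where f = f and x = x, OF a, of \<rho> 0 v] by (simp add: zero_ereal_def)
qed

text \<open>The subdifferential consists of the \<open>(\<rho>, 0)\<close>-subgradients, hence is
  cut out by one closed condition on \<open>v\<close> for each \<open>y\<close>. Closedness is what
  lets minimal-norm subgradients exist.\<close>

lemma closed_subdifferential:
  fixes f :: "'a::real_inner \<Rightarrow> ereal"
  assumes "proper_fun f" "weakly_convex \<rho> f" "\<rho> \<ge> 0"
  shows "closed (subdifferential f x)"
proof (cases "x \<in> edom f")
  case False
  then show ?thesis by (simp add: subdifferential_def)
next
  case True
  obtain a where a: "f x = ereal a" using edom_realE[OF assms(1) True] .
  have "subdifferential f x = {v. approx_subgradient \<rho> (ereal 0) f x v}"
    using approx_subgradient_imp_subdifferential[OF assms(1)]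
      subdifferential_weakly_convex[OF assms(1,2) _ assms(3)]
    by (auto simp: zero_ereal_def)
  also have "closed \<dots>"
    unfolding approx_subgradient_real_iff[where f = f and x = x, OF a]
    by (intro closed_Collect_all closed_Collect_le continuous_intros)
  finally show ?thesis .
qed

section \<open>From approximate subgradients to approximate stationarity\<close>

lemma approx_subgradient_imp_approx_stationary:
  fixes f :: "'a::euclidean_space \<Rightarrow> ereal"
  assumes proper: "proper_fun f" and lsc: "lower_semicontinuous f"
    and wc: "weakly_convex \<rho> f" and "\<rho> \<ge> 0" "\<epsilon> \<ge> 0"
    and v: "approx_subgradient \<rho>' (ereal \<epsilon>) f x v"
    and \<rho>h: "\<rho>' < \<rho>h" "\<rho> < \<rho>h"
  defines "\<delta> \<equiv> sqrt (2 * \<epsilon> / (\<rho>h - \<rho>))"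
  shows "approx_stationary \<delta> (norm v + \<rho>h * \<delta>) f x"
proof -
  have x: "x \<in> edom f" using v by (simp add: approx_subgradient_def)
  obtain a where a: "f x = ereal a" using edom_realE[OF proper x] .
  have lower: "ereal (a + v \<bullet> (y - x) - \<rho>' / 2 * (norm (y - x))\<^sup>2 - \<epsilon>) \<le> f y" for y
    using v unfolding approx_subgradient_real_iff[where f = f and x = x, OF a] by blast
  define q where "q y = \<rho>h / 2 * (norm (y - x))\<^sup>2 - v \<bullet> (y - x)" for y
  define g where "g y = f y + ereal (q y)" for y
  have "lower_semicontinuous g"
    unfolding g_def q_def using proper
    by (intro lower_semicontinuous_add_continuous lsc continuous_intros) (auto simp: proper_fun_def)
  \<comment> \<open>Outside this radius the growth
    \<open>(\<rho>h - \<rho>') / 2 * (norm (y - x))\<^sup>2\<close> outweighs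
    \<open>\<epsilon>\<close>, so \<open>g y \<ge> g x\<close> and a minimiser over the ball is
    global.\<close>
  define R where "R = sqrt (2 * \<epsilon> / (\<rho>h - \<rho>'))"
  have "R \<ge> 0" unfolding R_def using \<rho>h \<open>\<epsilon> \<ge> 0\<close> by simp
  obtain z where "z \<in> cball x R" and "\<forall>y\<in>cball x R. g z \<le> g y"
    using lower_semicontinuous_attains_inf[OF \<open>lower_semicontinuous g\<close>, of "cball x R"] \<open>R \<ge> 0\<close>
    by auto
  then have in_ball: "g z \<le> g y" if "y \<in> cball x R" for y using that by blast
  have min: "g z \<le> g y" for y
  proof (cases "y \<in> cball x R")
    case False
    then have "R\<^sup>2 \<le> (norm (y - x))\<^sup>2"
      using \<open>R \<ge> 0\<close> by (intro power_mono) (auto simp: dist_norm norm_minus_commute)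
    then have "2 * \<epsilon> / (\<rho>h - \<rho>') \<le> (norm (y - x))\<^sup>2"
      using \<open>\<epsilon> \<ge> 0\<close> \<rho>h by (simp add: R_def)
    then have "2 * \<epsilon> \<le> (\<rho>h - \<rho>') * (norm (y - x))\<^sup>2"
      using \<rho>h by (simp add: pos_divide_le_eq mult.commute)
    then have "ereal a \<le> ereal (a + v \<bullet> (y - x) - \<rho>' / 2 * (norm (y - x))\<^sup>2 - \<epsilon>) + ereal (q y)"
      by (simp add: q_def algebra_simps)
    also have "\<dots> \<le> g y" unfolding g_def by (intro add_right_mono lower)
    finally have "ereal a \<le> g y" .
    moreover have "g x = ereal a" by (simp add: g_def q_def a)
    moreover have "g z \<le> g x" using in_ball[of x] \<open>R \<ge> 0\<close> by simp
    ultimately show ?thesis by simp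
  qed (rule in_ball)
  have "f z \<noteq> \<infinity>" using min[of x] by (auto simp: g_def a)
  then have z: "z \<in> edom f" by (simp add: edom_def)
  obtain b where b: "f z = ereal b" using edom_realE[OF proper z] .
  define w where "w = v - \<rho>h *\<^sub>R (z - x)"
  have "ereal (b + w \<bullet> (y - z) - \<rho>h / 2 * (norm (y - z))\<^sup>2 - 0) \<le> f y" for y
  proof -
    \<comment> \<open>This is the exact Taylor expansion of the quadratic \<open>q\<close> at
      \<open>z\<close>, where its gradient is \<open>-w\<close>.\<close>
    have "w \<bullet> (y - z) - \<rho>h / 2 * (norm (y - z))\<^sup>2 = q z - q y"
      unfolding w_def q_def
      by (simp add: power2_norm_eq_inner inner_simps inner_commute)
         (simp add: algebra_simps add_divide_distrib diff_divide_distrib)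
    then show ?thesis using min[of y] by (cases "f y") (auto simp: g_def b)
  qed
  then have "approx_subgradient \<rho>h 0 f z w"
    using approx_subgradient_real_iff[where f = f and x = z, OF b, of \<rho>h 0 w] by (simp add: zero_ereal_def)
  then have w: "w \<in> subdifferential f z"
    by (rule approx_subgradient_imp_subdifferential[OF proper])
  \<comment> \<open>Passing through the subdifferential sharpens the quadratic constant from
    \<open>\<rho>h\<close> to \<open>\<rho>\<close>.\<close>
  then have "approx_subgradient \<rho> 0 f z w"
    using subdifferential_weakly_convex[OF proper wc] \<open>\<rho> \<ge> 0\<close> by blast
  then have "ereal (b + w \<bullet> (y - z) - \<rho> / 2 * (norm (y - z))\<^sup>2) \<le> f y" for y
    using approx_subgradient_real_iff[where f = f and x = z, OF b, of \<rho> 0 w]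
    by (simp add: zero_ereal_def)
  from this[of x] have 1: "b + w \<bullet> (x - z) - \<rho> / 2 * (norm (z - x))\<^sup>2 \<le> a"
    by (simp add: a norm_minus_commute)
  have 2: "a + v \<bullet> (z - x) - \<rho>' / 2 * (norm (z - x))\<^sup>2 - \<epsilon> \<le> b"
    using lower[of z] by (simp add: b)
  have 3: "w \<bullet> (x - z) = - (v \<bullet> (z - x)) + \<rho>h * (norm (z - x))\<^sup>2"
    unfolding w_def power2_norm_eq_inner
    by (simp add: inner_simps inner_commute) (simp add: algebra_simps)
  \<comment> \<open>Adding 1 and 2 leaves \<open>(\<rho>h - \<rho> / 2 - \<rho>' / 2) * (norm (z -
    x))\<^sup>2 \<le> \<epsilon>\<close>; replacing \<open>\<rho>'\<close> by \<open>\<rho>h\<close>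
    removes it from the bound.\<close>
  have "\<rho>' * (norm (z - x))\<^sup>2 \<le> \<rho>h * (norm (z - x))\<^sup>2"
    using \<rho>h by (intro mult_right_mono) auto
  then have "(\<rho>h - \<rho>) * (norm (z - x))\<^sup>2 \<le> 2 * \<epsilon>"
    using 1 2 3 by (simp add: left_diff_distrib)
  then have zx: "norm (z - x) \<le> \<delta>"
    using \<rho>h by (simp add: \<delta>_def real_le_rsqrt pos_le_divide_eq mult.commute)
  have "norm w \<le> norm v + \<rho>h * norm (z - x)"
    unfolding w_def using norm_triangle_ineq4[of v "\<rho>h *\<^sub>R (z - x)"] \<rho>h \<open>\<rho> \<ge> 0\<close> by simp
  also have "\<dots> \<le> norm v + \<rho>h * \<delta>"
    using zx \<rho>h \<open>\<rho> \<ge> 0\<close> by (intro add_left_mono mult_left_mono) auto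
  finally have "set_norm (subdifferential f z) \<le> ereal (norm v + \<rho>h * \<delta>)"
    using set_norm_le_norm[OF w] by (meson ereal_less_eq(3) order_trans)
  then show ?thesis unfolding approx_stationary_def using z zx by blast
qed

section \<open>From approximate stationarity to an approximate subgradient\<close>

lemma approx_stationary_imp_approx_subgradient:
  fixes f :: "'a::euclidean_space \<Rightarrow> ereal"
  assumes proper: "proper_fun f" and wc: "weakly_convex \<rho> f" and "\<rho> > 0"
    and x: "x \<in> edom f" and "\<eta> > 0" and stat: "approx_stationary (\<eta> / \<rho>) \<eta> f x"
  shows "\<exists>v. approx_subgradient \<rho>
      (ereal (2 * \<eta>\<^sup>2 / \<rho>) + ereal \<eta> * set_norm (subdifferential f x) / ereal \<rho>) f x v
    \<and> norm v \<le> 2 * \<eta>"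
proof (cases "subdifferential f x = {}")
  \<comment> \<open>Here the permitted error is infinite, so the zero vector works.\<close>
  case True
  then have "set_norm (subdifferential f x) = \<infinity>" by (simp add: set_norm_def top_ereal_def)
  then have "ereal (2 * \<eta>\<^sup>2 / \<rho>) + ereal \<eta> * set_norm (subdifferential f x) / ereal \<rho> = \<infinity>"
    using \<open>\<eta> > 0\<close> \<open>\<rho> > 0\<close> by simp
  moreover obtain a where "f x = ereal a" using edom_realE[OF proper x] .
  ultimately have "approx_subgradient \<rho>
      (ereal (2 * \<eta>\<^sup>2 / \<rho>) + ereal \<eta> * set_norm (subdifferential f x) / ereal \<rho>) f x 0"
    using x by (simp add: approx_subgradient_def)
  then show ?thesis using \<open>\<eta> > 0\<close> by (intro exI[of _ 0]) auto
next
  case False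
  have closed: "closed (subdifferential f y)" for y
    using closed_subdifferential[OF proper wc] \<open>\<rho> > 0\<close> by simp
  have global: "approx_subgradient \<rho> (ereal 0) f y u" if "u \<in> subdifferential f y" for u y
    using subdifferential_weakly_convex[OF proper wc that] \<open>\<rho> > 0\<close> by (simp add: zero_ereal_def)
  obtain z where z: "z \<in> edom f" and zx: "norm (z - x) \<le> \<eta> / \<rho>"
    and zs: "set_norm (subdifferential f z) \<le> ereal \<eta>"
    using stat by (auto simp: approx_stationary_def)
  have "subdifferential f z \<noteq> {}" using zs by (auto simp: set_norm_def top_ereal_def)
  then obtain v where v: "v \<in> subdifferential f z" "norm v \<le> \<eta>"
    using set_norm_attained[OF closed, of z] zs by (metis ereal_less_eq(3))
  obtain w where w: "w \<in> subdifferential f x" "set_norm (subdifferential f x) = ereal (norm w)"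
    using set_norm_attained[OF closed False] .
  obtain a where a: "f x = ereal a" using edom_realE[OF proper x] .
  obtain b where b: "f z = ereal b" using edom_realE[OF proper z] .
  \<comment> \<open>Recentring the quadratic from \<open>z\<close> to \<open>x\<close> changes it by
    an affine function of \<open>y\<close>, whose slope \<open>- \<rho> (x - z)\<close> is absorbed
    into \<open>u\<close>.\<close>
  define u where "u = v - \<rho> *\<^sub>R (x - z)"
  have "norm u \<le> norm v + \<rho> * norm (z - x)"
    unfolding u_def using norm_triangle_ineq4[of v "\<rho> *\<^sub>R (x - z)"] \<open>\<rho> > 0\<close>
    by (simp add: norm_minus_commute)
  also have "\<rho> * norm (z - x) \<le> \<eta>" using zx \<open>\<rho> > 0\<close> by (simp add: pos_le_divide_eq mult.commute)
  finally have u: "norm u \<le> 2 * \<eta>" using v(2) by simp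
  have "ereal (a + w \<bullet> (z - x) - \<rho> / 2 * (norm (z - x))\<^sup>2 - 0) \<le> f z"
    using global[OF w(1)] unfolding approx_subgradient_real_iff[where f = f and x = x, OF a] by blast
  then have 1: "a + w \<bullet> (z - x) - \<rho> / 2 * (norm (z - x))\<^sup>2 \<le> b" by (simp add: b)
  have inner_ge: "- (norm s * (\<eta> / \<rho>)) \<le> s \<bullet> y" if "norm y \<le> \<eta> / \<rho>" for s y :: 'a
    using Cauchy_Schwarz_ineq2[of s y] mult_left_mono[OF that norm_ge_zero[of s]] by linarith
  have 2: "- (norm w * (\<eta> / \<rho>)) \<le> w \<bullet> (z - x)"
    using zx by (rule inner_ge)
  have "- (norm v * (\<eta> / \<rho>)) \<le> v \<bullet> (x - z)"
    using zx by (intro inner_ge) (simp add: norm_minus_commute)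
  moreover have "norm v * (\<eta> / \<rho>) \<le> \<eta> * (\<eta> / \<rho>)"
    using v(2) \<open>\<eta> > 0\<close> \<open>\<rho> > 0\<close> by (intro mult_right_mono) auto
  ultimately have 3: "- (\<eta>\<^sup>2 / \<rho>) \<le> v \<bullet> (x - z)" by (simp add: power2_eq_square)
  have "\<rho> * (norm (z - x))\<^sup>2 \<le> \<rho> * (\<eta> / \<rho>)\<^sup>2"
    using zx \<open>\<rho> > 0\<close> by (intro mult_left_mono power_mono) auto
  then have 4: "\<rho> * (norm (z - x))\<^sup>2 \<le> \<eta>\<^sup>2 / \<rho>"
    using \<open>\<rho> > 0\<close> by (simp add: power_divide power2_eq_square)
  \<comment> \<open>Error budget: 2 contributes \<open>\<eta> * norm w / \<rho>\<close> and 3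
    contributes \<open>\<eta>\<^sup>2 / \<rho>\<close>. The quadratic terms from 1 and from
    recentring add up to \<open>\<rho> * (norm (z - x))\<^sup>2\<close>, which 4 bounds by another
    \<open>\<eta>\<^sup>2 / \<rho>\<close>.\<close>
  define \<epsilon> where "\<epsilon> = 2 * \<eta>\<^sup>2 / \<rho> + \<eta> * norm w / \<rho>"
  have "ereal (a + u \<bullet> (y - x) - \<rho> / 2 * (norm (y - x))\<^sup>2 - \<epsilon>) \<le> f y" for y
  proof -
    have "u \<bullet> (y - x) - \<rho> / 2 * (norm (y - x))\<^sup>2
      = v \<bullet> (y - z) - \<rho> / 2 * (norm (y - z))\<^sup>2 - v \<bullet> (x - z) + \<rho> / 2 * (norm (z - x))\<^sup>2"
      unfolding u_def
      by (simp add: power2_norm_eq_inner inner_simps inner_commute)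
         (simp add: algebra_simps add_divide_distrib diff_divide_distrib)
    moreover have "\<epsilon> = \<eta>\<^sup>2 / \<rho> + \<eta>\<^sup>2 / \<rho> + norm w * (\<eta> / \<rho>)"
      by (simp add: \<epsilon>_def field_simps)
    ultimately have "a + u \<bullet> (y - x) - \<rho> / 2 * (norm (y - x))\<^sup>2 - \<epsilon>
        \<le> b + v \<bullet> (y - z) - \<rho> / 2 * (norm (y - z))\<^sup>2 - 0"
      using 1 2 3 4 by simp
    moreover have "ereal (b + v \<bullet> (y - z) - \<rho> / 2 * (norm (y - z))\<^sup>2 - 0) \<le> f y"
      using global[OF v(1)] unfolding approx_subgradient_real_iff[where f = f and x = z, OF b] by blast
    ultimately show ?thesis by (meson ereal_less_eq(3) order_trans)
  qed
  then have "approx_subgradient \<rho> (ereal \<epsilon>) f x u"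
    unfolding approx_subgradient_real_iff[where f = f and x = x, OF a] by blast
  moreover have "ereal (2 * \<eta>\<^sup>2 / \<rho>) + ereal \<eta> * set_norm (subdifferential f x) / ereal \<rho> = ereal \<epsilon>"
    using \<open>\<rho> > 0\<close> by (simp add: \<epsilon>_def w(2))
  ultimately show ?thesis using u by auto
qed

theorem theorem3p1:
  fixes f :: "real ^ 'n \<Rightarrow> ereal" and \<rho> :: real and x :: "real ^ 'n"
  assumes "proper_fun f"
    and "lower_semicontinuous f"
    and "\<rho> > 0"
    and "weakly_convex \<rho> f"
    and "x \<in> edom f"
  shows "(\<forall>\<rho>' \<epsilon> v. \<rho>' \<ge> 0 \<longrightarrow> \<epsilon> \<ge> 0 \<longrightarrow> approx_subgradient \<rho>' (ereal \<epsilon>) f x v \<longrightarrow>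
            (\<forall>\<rho>h. \<rho>h > max \<rho>' \<rho> \<longrightarrow>
               approx_stationary (sqrt (2 * \<epsilon> / (\<rho>h - \<rho>)))
                 (norm v + \<rho>h * sqrt (2 * \<epsilon> / (\<rho>h - \<rho>))) f x)
            \<and> (\<epsilon> = 0 \<and> \<rho>' = \<rho> \<longrightarrow> v \<in> subdifferential f x))
       \<and> (\<forall>\<eta>. \<eta> > 0 \<longrightarrow> approx_stationary (\<eta> / \<rho>) \<eta> f x \<longrightarrow>
            (\<exists>v. approx_subgradient \<rho>
                   (ereal (2 * \<eta>\<^sup>2 / \<rho>) + ereal \<eta> * set_norm (subdifferential f x) / ereal \<rho>) f x v
               \<and> norm v \<le> 2 * \<eta>))"
proof (intro conjI allI impI)
  fix \<rho>' \<epsilon> \<rho>h :: real and v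
  assume "\<epsilon> \<ge> 0" and v: "approx_subgradient \<rho>' (ereal \<epsilon>) f x v" and "\<rho>h > max \<rho>' \<rho>"
  then show "approx_stationary (sqrt (2 * \<epsilon> / (\<rho>h - \<rho>)))
      (norm v + \<rho>h * sqrt (2 * \<epsilon> / (\<rho>h - \<rho>))) f x"
    using assms by (intro approx_subgradient_imp_approx_stationary[OF _ _ _ _ _ v]) auto
next
  fix \<rho>' \<epsilon> :: real and v
  assume "approx_subgradient \<rho>' (ereal \<epsilon>) f x v" "\<epsilon> = 0 \<and> \<rho>' = \<rho>"
  then show "v \<in> subdifferential f x"
    using approx_subgradient_imp_subdifferential[OF assms(1)] by (auto simp: zero_ereal_def)
next
  fix \<eta> :: real
  assume "\<eta> > 0" "approx_stationary (\<eta> / \<rho>) \<eta> f x"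
  then show "\<exists>v. approx_subgradient \<rho>
        (ereal (2 * \<eta>\<^sup>2 / \<rho>) + ereal \<eta> * set_norm (subdifferential f x) / ereal \<rho>) f x v
      \<and> norm v \<le> 2 * \<eta>"
    using approx_stationary_imp_approx_subgradient assms by blast
qed

end
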